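(* Let $\mathscr{M}$ be a statistical model, $\Psi:\mathscr{M}\to\mathbb{R}$ a pathwise differentiable parameter with efficient influence function $\phi_Q$ at each $Q\in\mathscr{M}$, let $P\in\mathscr{M}$ and let $x\in\mathscr{X}(P)$ be an observation value. Let $H_{x,\lambda}$ ($\lambda>0$), $P_{\epsilon,\lambda}=(1-\epsilon)P+\epsilon H_{x,\lambda}$, the Kullback--Leibler projection $P^*_{\epsilon,\lambda}$ of $P_{\epsilon,\lambda}$, $\phi^*_{\epsilon,\lambda}=\phi_{P^*_{\epsilon,\lambda}}$ and the remainder $R$ be as defined in the context. Suppose that $P^*_{\epsilon,\lambda}$ exists and is in $\mathscr{M}$ for all sufficiently small $\epsilon$ and $\lambda$. Suppose further that (A1) $\int \phi^*_{\epsilon,\lambda}(u)\,dP_{\epsilon,\lambda}(u)=0$ (for all sufficiently small $\epsilon$ and $\lambda$); (A2) $\lim_{\lambda\to 0}\lim_{\epsilon\to 0}\int \phi^*_{\epsilon,\lambda}(u)\,d(H_{x,\lambda}-P)(u)=\phi_P(x)$; (A3) $\lim_{\lambda\to 0}\lim_{\epsilon\to 0}R(P^*_{\epsilon,\lambda},P)/\epsilon=0$. Then the efficient influence function of $\Psi$ relative to $\mathscr{M}$ at $P$ evaluated at $x$ is given by $$\phi_P(x)\;=\;\lim_{\lambda\to 0}\left.\frac{d}{d\epsilon}\Psi(P^*_{\epsilon,\lambda})\right|_{\epsilon=0}\;=\;\lim_{\lambda\to 0}\lim_{\epsilon\to 0}\frac{\Psi(P^*_{\epsilon,\lambda})-\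Psi(P)}{\epsilon}.$$
   Context: Model and parameter. $\mathscr{M}$ is a collection of probability distributions on $\mathbb{R}^d$; $\mathscr{X}(P)\subseteq\mathbb{R}^d$ is the sample space associated with $P\in\mathscr{M}$. $L_2^0(P)$ is the Hilbert space of real-valued functions on $\mathscr{X}(P)$ with mean zero and finite variance under $P$. The parameter $\Psi:\mathscr{M}\to\mathbb{R}$ is pathwise differentiable at $P$ if there is $\chi_P\in L_2^0(P)$ such that, for each regular one-dimensional parametric submodel $\{P_\epsilon:\epsilon\in\mathscr{E}\}\subseteq\mathscr{M}$, with $\mathscr{E}\subset\mathbb{R}$ an interval containing zero and $P_{\epsilon=0}=P$, one has $\frac{d}{d\epsilon}\Psi(P_\epsilon)|_{\epsilon=0}=\int\chi_P(u)s(u)\,dP(u)$, where $s$ is the score for $\epsilon$ at $\epsilon=0$ in the submodel; any such $\chi_P$ is called a gradient of $\Psi$ at $P$ relative to $\mathscr{M}$. The tangent space $T_{\mathscr{M}}(P)$ is the closure in $L_2^0(P)$ of the linear span of scores at $P$ arising from regular one-dimensional parametric submodels of $\mathscr{M}$ through $P$. The efficient influence function (EIF) $\phi_P$ is the unique gradient contained in $T_{\mathscr{M}}(P)$ (the canonical gradient). $\Psi$ is assumed pathwise differentiable, so that $\phi_Q$ is defined for $Q\in\mathscr{M}$. Remainder. For $P_1,P\in\mathscr{M}$, $R(P_1,P)$ is the remainder in the linearization $\Psi(P_1)-\Psi(P)=-\int\phi_{P_1}(u)\,dP(u)+R(P_1,P)$, i.e. $R(P_1,P):=\Psi(P_1)-\Psi(P)+\int\phi_{P_1}(u)\,dP(u)$.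 Perturbation and projection. For $\lambda>0$, $H_{x,\lambda}$ is a probability distribution symmetric about $x$, dominated by $P$, and such that $\int g(u)\,dH_{x,\lambda}(u)\to g(x)$ as $\lambda\to0$ for all $g$ in a sufficiently large class of functions. For $0\le\epsilon\le1$, $P_{\epsilon,\lambda}:=(1-\epsilon)P+\epsilon H_{x,\lambda}$. Let $\mathscr{M}(P):=\{P_1\in\mathscr{M}:P_1\ll P\}$ and let $\nu$ be a measure dominating $P$. The projection is $$P^*_{\epsilon,\lambda}:=\operatorname{argmax}_{P_1\in\mathscr{M}(P)}\int\log\left\{\frac{dP_1}{d\nu}(u)\right\}dP_{\epsilon,\lambda}(u),$$ so that $P^*_{0,\lambda}=P$. Write $\phi^*_{\epsilon,\lambda}:=\phi_{P^*_{\epsilon,\lambda}}$. Conventions. Limits in $\epsilon$ and $\lambda$ are one-sided ($\epsilon\downarrow0$, $\lambda\downarrow0$), derivatives in $\epsilon$ at $\epsilon=0$ are right derivatives, and iterated limits are taken with the inner limit ($\epsilon\to0$) at fixed $\lambda$ first, followed by $\lambda\to0$. All integrals appearing are understood to be well defined. *)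

theory Defs
  imports "HOL-Probability.Probability"
begin

section \<open>Models, scores, gradients\<close>

text \<open>\<open>X P\<close> is the sample space of \<open>P\<close>. Distributions are measures on the Borel sets of the whole of
  Euclidean space, and a function on \<open>X P\<close> is represented by a total function; its values off \<open>X P\<close>
  are irrelevant up to \<open>P\<close>-null sets.\<close>

definition statistical_model ::
  "(real ^ 'd) measure set \<Rightarrow> ((real ^ 'd) measure \<Rightarrow> (real ^ 'd) set) \<Rightarrow> bool" where
  "statistical_model M X \<longleftrightarrow>
     (\<forall>P\<in>M. prob_space P \<and> sets P = sets borel \<and> X P \<in> sets borel \<and> (AE u in P. u \<in> X P))"

definition L20 :: "(real ^ 'd) measure \<Rightarrow> (real ^ 'd \<Rightarrow> real) set" where
  "L20 P = {f \<in> borel_measurable P. integrable P (\<lambda>u. (f u)\<^sup>2) \<and> (\<integral>u. f u \<partial>P) = 0}"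

text \<open>\<open>(E, p)\<close> is a regular one-dimensional submodel of \<open>M\<close> through \<open>P\<close> with score \<open>s\<close> at \<open>0\<close>.
  Regularity is differentiability in quadratic mean at \<open>0\<close>, with respect to a \<open>\<sigma>\<close>-finite measure
  dominating the submodel. The integral is a nonnegative one, so that its convergence to \<open>0\<close>
  includes its finiteness near \<open>0\<close>. The interval \<open>E\<close> may have \<open>0\<close> as an end point; only the
  degenerate interval is excluded, on which derivatives at \<open>0\<close> would be meaningless.\<close>

definition regular_submodel ::
  "(real ^ 'd) measure set \<Rightarrow> (real ^ 'd) measure \<Rightarrow> real set \<Rightarrow> (real \<Rightarrow> (real ^ 'd) measure)
     \<Rightarrow> (real ^ 'd \<Rightarrow> real) \<Rightarrow> bool" where
  "regular_submodel M P E p s \<longleftrightarrow>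
     is_interval E \<and> 0 \<in> E \<and> E \<noteq> {0} \<and> (\<forall>\<epsilon>\<in>E. p \<epsilon> \<in> M) \<and> p 0 = P \<and> s \<in> L20 P \<and>
     (\<exists>\<mu>. sigma_finite_measure \<mu> \<and> sets \<mu> = sets borel \<and>
        (\<forall>\<epsilon>\<in>E. absolutely_continuous \<mu> (p \<epsilon>)) \<and>
        (let r = (\<lambda>\<epsilon> u. sqrt (enn2real (RN_deriv \<mu> (p \<epsilon>) u))) in
          ((\<lambda>\<epsilon>. \<integral>\<^sup>+u. ennreal (((r \<epsilon> u - r 0 u) / \<epsilon> - 1 / 2 * s u * r 0 u)\<^sup>2) \<partial>\<mu>) \<longlongrightarrow> 0)
            (at 0 within E)))"

definition scores ::
  "(real ^ 'd) measure set \<Rightarrow> (real ^ 'd) measure \<Rightarrow> (real ^ 'd \<Rightarrow> real) set" where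
  "scores M P = {s. \<exists>E p. regular_submodel M P E p s}"

definition score_span ::
  "(real ^ 'd) measure set \<Rightarrow> (real ^ 'd) measure \<Rightarrow> (real ^ 'd \<Rightarrow> real) set" where
  "score_span M P = {\<lambda>u. \<Sum>s\<in>S. c s * s u | S c. finite S \<and> S \<subseteq> scores M P}"

definition tangent_space ::
  "(real ^ 'd) measure set \<Rightarrow> (real ^ 'd) measure \<Rightarrow> (real ^ 'd \<Rightarrow> real) set" where
  "tangent_space M P =
     {f \<in> L20 P. \<forall>e>0. \<exists>g\<in>score_span M P. sqrt (\<integral>u. (f u - g u)\<^sup>2 \<partial>P) < e}"

definition is_gradient ::
  "(real ^ 'd) measure set \<Rightarrow> ((real ^ 'd) measure \<Rightarrow> real) \<Rightarrow> (real ^ 'd) measure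
     \<Rightarrow> (real ^ 'd \<Rightarrow> real) \<Rightarrow> bool" where
  "is_gradient M \<Psi> P g \<longleftrightarrow> g \<in> L20 P \<and>
     (\<forall>E p s. regular_submodel M P E p s \<longrightarrow>
        ((\<lambda>\<epsilon>. \<Psi> (p \<epsilon>)) has_real_derivative (\<integral>u. g u * s u \<partial>P)) (at 0 within E))"

definition pathwise_differentiable ::
  "(real ^ 'd) measure set \<Rightarrow> ((real ^ 'd) measure \<Rightarrow> real) \<Rightarrow> (real ^ 'd) measure \<Rightarrow> bool" where
  "pathwise_differentiable M \<Psi> P \<longleftrightarrow> (\<exists>g. is_gradient M \<Psi> P g)"

text \<open>A gradient in the tangent space is unique only as an element of \<open>L\<^sub>2\<close>, that is, up to \<open>P\<close>-a.e.
  equality; \<open>is_EIF\<close> says that \<open>\<phi>\<close> is one of its versions.\<close>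

definition is_EIF ::
  "(real ^ 'd) measure set \<Rightarrow> ((real ^ 'd) measure \<Rightarrow> real) \<Rightarrow> (real ^ 'd) measure
     \<Rightarrow> (real ^ 'd \<Rightarrow> real) \<Rightarrow> bool" where
  "is_EIF M \<Psi> P \<phi> \<longleftrightarrow> is_gradient M \<Psi> P \<phi> \<and> \<phi> \<in> tangent_space M P"

definition remainder ::
  "((real ^ 'd) measure \<Rightarrow> real) \<Rightarrow> ((real ^ 'd) measure \<Rightarrow> real ^ 'd \<Rightarrow> real)
     \<Rightarrow> (real ^ 'd) measure \<Rightarrow> (real ^ 'd) measure \<Rightarrow> real" where
  "remainder \<Psi> \<phi> P1 P = \<Psi> P1 - \<Psi> P + (\<integral>u. \<phi> P1 u \<partial>P)"


section \<open>Perturbation and Kullback--Leibler projection\<close>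

text \<open>\<open>G\<close> is the class of functions at which \<open>H lam\<close> approximates the point mass at \<open>x\<close>.\<close>

definition smoothing_family ::
  "(real ^ 'd) measure \<Rightarrow> real ^ 'd \<Rightarrow> (real ^ 'd \<Rightarrow> real) set \<Rightarrow> (real \<Rightarrow> (real ^ 'd) measure)
     \<Rightarrow> bool" where
  "smoothing_family P x G H \<longleftrightarrow>
     (\<forall>lam>0. prob_space (H lam) \<and> sets (H lam) = sets borel \<and>
        distr (H lam) borel (\<lambda>u. 2 *\<^sub>R x - u) = H lam \<and> absolutely_continuous P (H lam)) \<and>
     (\<forall>g\<in>G. (\<forall>\<^sub>F lam in at_right 0. integrable (H lam) g) \<and>
        ((\<lambda>lam. \<integral>u. g u \<partial>H lam) \<longlongrightarrow> g x) (at_right 0))"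

definition mixture ::
  "real \<Rightarrow> (real ^ 'd) measure \<Rightarrow> (real ^ 'd) measure \<Rightarrow> (real ^ 'd) measure" where
  "mixture \<epsilon> P Q = measure_of (space P) (sets P)
     (\<lambda>A. ennreal (1 - \<epsilon>) * emeasure P A + ennreal \<epsilon> * emeasure Q A)"

text \<open>The integral of the log-density of \<open>P1\<close> under \<open>Q\<close> is extended-real valued: it is \<open>-\<infinity>\<close> if the
  density vanishes on a set of positive \<open>Q\<close>-probability. Neither \<open>ln 0 = 0\<close> nor the value \<open>0\<close> of
  a non-existing Bochner integral may enter the maximisation. Note that \<open>e2ennreal\<close> maps negative
  numbers to \<open>0\<close>.\<close>

definition elog :: "ennreal \<Rightarrow> ereal" where
  "elog y = (if y = 0 then -\<infinity> else if y = \<infinity> then \<infinity> else ereal (ln (enn2real y)))"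

definition loglik_pos ::
  "(real ^ 'd) measure \<Rightarrow> (real ^ 'd) measure \<Rightarrow> (real ^ 'd) measure \<Rightarrow> ennreal" where
  "loglik_pos \<nu> Q P1 = (\<integral>\<^sup>+u. e2ennreal (elog (RN_deriv \<nu> P1 u)) \<partial>Q)"

definition loglik_neg ::
  "(real ^ 'd) measure \<Rightarrow> (real ^ 'd) measure \<Rightarrow> (real ^ 'd) measure \<Rightarrow> ennreal" where
  "loglik_neg \<nu> Q P1 = (\<integral>\<^sup>+u. e2ennreal (- elog (RN_deriv \<nu> P1 u)) \<partial>Q)"

definition loglik_defined ::
  "(real ^ 'd) measure \<Rightarrow> (real ^ 'd) measure \<Rightarrow> (real ^ 'd) measure \<Rightarrow> bool" where
  "loglik_defined \<nu> Q P1 \<longleftrightarrow> loglik_pos \<nu> Q P1 < \<infinity> \<or> loglik_neg \<nu> Q P1 < \<infinity>"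

definition loglik ::
  "(real ^ 'd) measure \<Rightarrow> (real ^ 'd) measure \<Rightarrow> (real ^ 'd) measure \<Rightarrow> ereal" where
  "loglik \<nu> Q P1 = enn2ereal (loglik_pos \<nu> Q P1) - enn2ereal (loglik_neg \<nu> Q P1)"

definition dominated_submodel ::
  "(real ^ 'd) measure set \<Rightarrow> (real ^ 'd) measure \<Rightarrow> (real ^ 'd) measure set" where
  "dominated_submodel M P = {P1 \<in> M. absolutely_continuous P P1}"

definition KL_projection ::
  "(real ^ 'd) measure set \<Rightarrow> (real ^ 'd) measure \<Rightarrow> (real ^ 'd) measure \<Rightarrow> (real ^ 'd) measure
     \<Rightarrow> (real ^ 'd) measure" where
  "KL_projection M P \<nu> Q = arg_max (loglik \<nu> Q) (\<lambda>P1. P1 \<in> dominated_submodel M P)"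

text \<open>As \<open>arg_max\<close> chooses an arbitrary maximiser, for the projection to be a well-defined
  distribution there has to be exactly one maximiser.\<close>

definition KL_projection_exists ::
  "(real ^ 'd) measure set \<Rightarrow> (real ^ 'd) measure \<Rightarrow> (real ^ 'd) measure \<Rightarrow> (real ^ 'd) measure
     \<Rightarrow> bool" where
  "KL_projection_exists M P \<nu> Q \<longleftrightarrow>
     (\<forall>P1\<in>dominated_submodel M P. loglik_defined \<nu> Q P1) \<and>
     (\<exists>!P1. is_arg_max (loglik \<nu> Q) (\<lambda>P1. P1 \<in> dominated_submodel M P) P1)"


section \<open>Iterated one-sided limits\<close>

text \<open>The inner limit (\<open>\<epsilon> \<down> 0\<close>) at fixed \<open>lam\<close> has to exist for all small \<open>lam\<close>.\<close>

definition iterated_limit :: "(real \<Rightarrow> real \<Rightarrow> real) \<Rightarrow> real \<Rightarrow> bool" where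
  "iterated_limit F l \<longleftrightarrow>
     (\<exists>L. (\<forall>\<^sub>F lam in at_right 0. ((\<lambda>\<epsilon>. F \<epsilon> lam) \<longlongrightarrow> L lam) (at_right 0)) \<and> (L \<longlongrightarrow> l) (at_right 0))"

end

theory Submission
  imports Defs
begin

text \<open>
  The gradient \<open>\<phi>\<^sub>Q\<close> at the projection \<open>Q = P\<^sup>*\<close> of the mixture \<open>(1 - \<epsilon>) P + \<epsilon> H\<close> has mean zero under
  that mixture. As the mixture is affine in \<open>\<epsilon>\<close>, this says that \<open>- \<integral> \<phi>\<^sub>Q dP\<close>, which is the linear
  term of the expansion of \<open>\<Psi> Q - \<Psi> P\<close>, equals \<open>\<epsilon> \<integral> \<phi>\<^sub>Q d(H - P)\<close>. Dividing the expansion by \<open>\<epsilon>\<close>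
  thus gives the exact identity

    \<open>(\<Psi> Q - \<Psi> P) / \<epsilon> = \<integral> \<phi>\<^sub>Q d(H - P) + R(Q, P) / \<epsilon>\<close>,

  which is \<open>difference_quotient_eq\<close>, and the two terms on the right have the iterated limits
  \<open>\<phi>\<^sub>P(x)\<close> and \<open>0\<close>.

  That the inner limit of the quotients is a right derivative at \<open>0\<close> needs one thing more: the curve
  \<open>\<epsilon> \<mapsto> \<Psi>(P\<^sup>*)\<close> has to take the value \<open>\<Psi> P\<close> at \<open>\<epsilon> = 0\<close>, so \<open>P\<close> has to be its own projection
  (\<open>KL_projection_self\<close>). This is Gibbs' inequality, \<open>\<integral> log q dP \<le> \<integral> log p dP\<close> for densities
  \<open>p\<close> of \<open>P\<close> and \<open>q\<close> of a competitor, together with the uniqueness of the maximiser. Both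
  sides of Gibbs' inequality may be \<open>\<infinity>\<close> or \<open>-\<infinity>\<close>, so the integral of \<open>log (q / p)\<close> cannot be
  computed as their difference. The inequality is therefore integrated in the form \<open>elog_diff_le\<close>, in
  which positive and negative parts of the logarithms are moved to the sides where they have a plus
  sign.
\<close>

section \<open>Integrals under mixtures\<close>

lemma mixture_zero: "mixture 0 P Q = P"
  unfolding mixture_def by (simp add: measure_of_of_measure)

text \<open>
  A mixture is specified by its values on sets only. Exhibiting it as a measure with density spares a
  proof of countable additivity, and brings its integrals back to integrals under \<open>P\<close>.
\<close>

lemma mixture_eq_density:
  assumes P: "prob_space P" and Q: "prob_space Q" "sets Q = sets P" "absolutely_continuous P Q"
    and \<epsilon>: "0 \<le> \<epsilon>" "\<epsilon> \<le> 1"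
  obtains D where "D \<in> borel_measurable P" "\<And>u. 0 \<le> D u"
    "Q = density P (\<lambda>u. ennreal (D u))"
    "mixture \<epsilon> P Q = density P (\<lambda>u. ennreal (1 - \<epsilon> + \<epsilon> * D u))"
proof -
  interpret P: prob_space P by fact
  interpret Q: prob_space Q by fact
  obtain D where D: "D \<in> borel_measurable P" "AE u in P. RN_deriv P Q u = ennreal (D u)"
      "\<And>u. 0 \<le> D u"
    using P.real_RN_deriv[OF Q.finite_measure_axioms Q(3,2)] by metis
  have Q_eq: "Q = density P (\<lambda>u. ennreal (D u))"
  proof -
    have "Q = density P (RN_deriv P Q)"
      using P.density_RN_deriv[OF Q(3,2)] by simp
    also have "\<dots> = density P (\<lambda>u. ennreal (D u))"
      using D by (intro density_cong) auto
    finally show ?thesis .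
  qed
  let ?N = "density P (\<lambda>u. ennreal (1 - \<epsilon> + \<epsilon> * D u))"
  have split: "ennreal (1 - \<epsilon> + \<epsilon> * D u) = ennreal (1 - \<epsilon>) + ennreal \<epsilon> * ennreal (D u)" for u
    using \<epsilon> D(3)[of u] by (simp add: ennreal_plus ennreal_mult)
  have em: "emeasure ?N A = ennreal (1 - \<epsilon>) * emeasure P A + ennreal \<epsilon> * emeasure Q A"
    if A: "A \<in> sets P" for A
  proof -
    have "emeasure ?N A = (\<integral>\<^sup>+u. ennreal (1 - \<epsilon>) * indicator A u
        + ennreal \<epsilon> * (ennreal (D u) * indicator A u) \<partial>P)"
      using A D(1) by (simp add: emeasure_density split distrib_right mult.assoc)
    also have "\<dots> = ennreal (1 - \<epsilon>) * emeasure P A + ennreal \<epsilon> * emeasure Q A"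
      using A D(1) by (subst Q_eq) (simp add: nn_integral_add nn_integral_cmult emeasure_density)
    finally show ?thesis .
  qed
  have "mixture \<epsilon> P Q = measure_of (space ?N) (sets ?N) (emeasure ?N)"
    unfolding mixture_def space_density sets_density
    by (rule measure_of_eq[OF sets.space_closed]) (simp add: em sets.sigma_sets_eq)
  then have "mixture \<epsilon> P Q = ?N"
    unfolding measure_of_of_measure .
  with D Q_eq that show ?thesis by blast
qed

text \<open>
  Integrability under both components comes for free: with weights strictly between \<open>0\<close> and \<open>1\<close>,
  each component is dominated by a multiple of the mixture.
\<close>

lemma integral_mixture:
  assumes P: "prob_space P" and Q: "prob_space Q" "sets Q = sets P" "absolutely_continuous P Q"
    and \<epsilon>: "0 < \<epsilon>" "\<epsilon> < 1" and f: "integrable (mixture \<epsilon> P Q) f"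
  shows "(\<integral>u. f u \<partial>mixture \<epsilon> P Q) = (1 - \<epsilon>) * (\<integral>u. f u \<partial>P) + \<epsilon> * (\<integral>u. f u \<partial>Q)"
proof -
  obtain D where D[measurable]: "D \<in> borel_measurable P" and D0: "\<And>u. 0 \<le> D u"
    and Q_eq: "Q = density P (\<lambda>u. ennreal (D u))"
    and mix: "mixture \<epsilon> P Q = density P (\<lambda>u. ennreal (1 - \<epsilon> + \<epsilon> * D u))"
    using mixture_eq_density[OF P Q, of \<epsilon>] \<epsilon> by auto
  have w0: "0 \<le> 1 - \<epsilon> + \<epsilon> * D u" for u
    using \<epsilon> D0[of u] by simp
  have [measurable]: "f \<in> borel_measurable P"
    using borel_measurable_integrable[OF f] by (simp add: mix)
  have wf: "integrable P (\<lambda>u. (1 - \<epsilon> + \<epsilon> * D u) * f u)"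
    using f w0 by (simp add: mix integrable_density)
  have intP: "integrable P f"
  proof (rule Bochner_Integration.integrable_bound)
    show "integrable P (\<lambda>u. (1 - \<epsilon> + \<epsilon> * D u) * f u / (1 - \<epsilon>))"
      using wf by simp
    show "AE u in P. norm (f u) \<le> norm ((1 - \<epsilon> + \<epsilon> * D u) * f u / (1 - \<epsilon>))"
    proof (rule AE_I2)
      fix u
      have "(1 - \<epsilon>) * \<bar>f u\<bar> \<le> (1 - \<epsilon> + \<epsilon> * D u) * \<bar>f u\<bar>"
        using \<epsilon> D0[of u] by (intro mult_right_mono) auto
      then show "norm (f u) \<le> norm ((1 - \<epsilon> + \<epsilon> * D u) * f u / (1 - \<epsilon>))"
        using \<epsilon> w0[of u] by (simp add: abs_mult pos_le_divide_eq mult.commute)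
    qed
  qed simp
  have "integrable P (\<lambda>u. ((1 - \<epsilon> + \<epsilon> * D u) * f u - (1 - \<epsilon>) * f u) / \<epsilon>)"
    using wf intP by simp
  then have Df: "integrable P (\<lambda>u. D u * f u)"
    using \<epsilon> by (simp add: algebra_simps)
  have "(\<integral>u. f u \<partial>mixture \<epsilon> P Q) = (\<integral>u. (1 - \<epsilon>) * f u + \<epsilon> * (D u * f u) \<partial>P)"
    using w0 by (simp add: mix integral_density algebra_simps)
  also have "\<dots> = (1 - \<epsilon>) * (\<integral>u. f u \<partial>P) + \<epsilon> * (\<integral>u. D u * f u \<partial>P)"
    using intP Df by simp
  also have "(\<integral>u. D u * f u \<partial>P) = (\<integral>u. f u \<partial>Q)"
    using D0 by (simp add: Q_eq integral_density)
  finally show ?thesis .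
qed

section \<open>Gibbs' inequality and the projection at zero\<close>

text \<open>
  This is \<open>log q \<le> log p + q / p - 1\<close>, rearranged so that no difference of infinite quantities can
  arise: \<open>e2ennreal\<close> of \<open>elog\<close> and of \<open>- elog\<close> are the positive and negative parts of the logarithm.
\<close>

lemma elog_diff_le:
  assumes "0 < p"
  shows "e2ennreal (elog q) + e2ennreal (- elog (ennreal p)) + 1
    \<le> e2ennreal (elog (ennreal p)) + e2ennreal (- elog q) + q / ennreal p"
proof -
  consider "q = 0" | "q = \<infinity>" | r where "0 < r" "q = ennreal r"
    by (cases q) (auto simp: less_eq_real_def)
  then show ?thesis
  proof cases
    case 3
    have "ln r + 1 \<le> ln p + r / p"
      using ln_le_minus_one[of "r / p"] 3 assms by (simp add: ln_div)
    then have "max 0 (ln r) + max 0 (- ln p) + 1 \<le> max 0 (ln p) + max 0 (- ln r) + r / p"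
      by linarith
    then have "ennreal (max 0 (ln r) + max 0 (- ln p) + 1)
        \<le> ennreal (max 0 (ln p) + max 0 (- ln r) + r / p)"
      by (rule ennreal_leI)
    moreover have "ennreal (max 0 a + max 0 b + c) = ennreal a + ennreal b + ennreal c"
      if "0 \<le> c" for a b c
      using that by (simp add: ennreal_plus ennreal_max_0)
    ultimately have "ennreal (ln r) + ennreal (- ln p) + 1
        \<le> ennreal (ln p) + ennreal (- ln r) + ennreal (r / p)"
      using 3 assms by simp
    then show ?thesis
      using 3 assms by (simp add: elog_def divide_ennreal)
  qed (use assms in \<open>auto simp: elog_def ennreal_top_divide\<close>)
qed

lemma borel_measurable_elog[measurable]: "elog \<in> borel_measurable borel"
  unfolding elog_def by measurable

text \<open>
  Gibbs' inequality for possibly infinite log-likelihoods. Integrating \<open>elog_diff_le\<close> under \<open>P\<close>, the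
  \<open>1\<close> on the left absorbs the integral of \<open>q / p\<close> on the right, since
  \<open>\<integral> q / p dP \<le> \<integral> q d\<nu> = 1\<close>; it is only an inequality, as \<open>q\<close> may have mass where \<open>p\<close> vanishes.
\<close>

lemma loglik_le_self:
  assumes P: "prob_space P" and P1: "prob_space P1" "sets P1 = sets P"
    and nu: "sigma_finite_measure \<nu>" "sets P = sets \<nu>" "absolutely_continuous \<nu> P"
      "absolutely_continuous \<nu> P1"
    and defd: "loglik_defined \<nu> P P1"
  shows "loglik \<nu> P P1 \<le> loglik \<nu> P P"
proof -
  interpret nu: sigma_finite_measure \<nu> by fact
  interpret P: prob_space P by fact
  interpret P1: prob_space P1 by fact
  obtain p where [measurable]: "p \<in> borel_measurable \<nu>"
    and p: "AE u in \<nu>. RN_deriv \<nu> P u = ennreal (p u)" "AE u in P. 0 < p u"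
    using nu.real_RN_deriv[OF P.finite_measure_axioms nu(3,2)] by metis
  define q where "q = RN_deriv \<nu> P1"
  have [measurable]: "q \<in> borel_measurable \<nu>" unfolding q_def by simp
  have mP: "borel_measurable P = borel_measurable \<nu>"
    by (rule measurable_cong_sets) (simp_all add: nu)
  have P_eq: "density \<nu> (\<lambda>u. ennreal (p u)) = P"
    using nu.density_RN_deriv[OF nu(3,2)] p(1) density_cong[of "RN_deriv \<nu> P" \<nu> "\<lambda>u. ennreal (p u)"]
    by simp
  have P1_eq: "density \<nu> q = P1"
    using nu.density_RN_deriv[OF nu(4)] P1 nu q_def by simp
  have ae: "AE u in P. RN_deriv \<nu> P u = ennreal (p u)"
    by (rule absolutely_continuous_AE[OF _ nu(3) p(1)]) (simp add: nu)
  have "(\<integral>\<^sup>+u. q u / ennreal (p u) \<partial>P) = (\<integral>\<^sup>+u. ennreal (p u) * (q u / ennreal (p u)) \<partial>\<nu>)"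
    by (subst P_eq[symmetric]) (simp add: nn_integral_density)
  also have "\<dots> \<le> (\<integral>\<^sup>+u. q u \<partial>\<nu>)"
  proof (rule nn_integral_mono)
    fix u
    show "ennreal (p u) * (q u / ennreal (p u)) \<le> q u"
      by (cases "0 < p u")
        (simp_all add: ennreal_times_divide ennreal_mult_divide_eq mult.commute[of "ennreal (p u)"] ennreal_neg)
  qed
  also have "\<dots> = 1"
    using P1.emeasure_space_1 nn_integral_density[of q \<nu> "\<lambda>_. 1"] by (simp add: P1_eq)
  finally have ratio: "(\<integral>\<^sup>+u. q u / ennreal (p u) \<partial>P) \<le> 1" .
  let ?a = "loglik_pos \<nu> P P1" and ?b = "loglik_neg \<nu> P P1"
  let ?c = "loglik_pos \<nu> P P" and ?d = "loglik_neg \<nu> P P"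
  have c: "?c = (\<integral>\<^sup>+u. e2ennreal (elog (ennreal (p u))) \<partial>P)"
    unfolding loglik_pos_def using ae by (intro nn_integral_cong_AE) auto
  have d: "?d = (\<integral>\<^sup>+u. e2ennreal (- elog (ennreal (p u))) \<partial>P)"
    unfolding loglik_neg_def using ae by (intro nn_integral_cong_AE) auto
  have "?a + ?d + 1 = (\<integral>\<^sup>+u. e2ennreal (elog (q u)) + e2ennreal (- elog (ennreal (p u))) + 1 \<partial>P)"
    unfolding d loglik_pos_def q_def[symmetric]
    by (simp add: nn_integral_add mP P.emeasure_space_1)
  also have "\<dots> \<le> (\<integral>\<^sup>+u. e2ennreal (elog (ennreal (p u))) + e2ennreal (- elog (q u))
      + q u / ennreal (p u) \<partial>P)"
    using p(2) by (intro nn_integral_mono_AE) (auto elim!: eventually_mono intro: elog_diff_le)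
  also have "\<dots> = ?c + ?b + (\<integral>\<^sup>+u. q u / ennreal (p u) \<partial>P)"
    unfolding c loglik_neg_def q_def[symmetric] by (simp add: nn_integral_add mP)
  also have "\<dots> \<le> ?c + ?b + 1"
    using ratio by (intro add_left_mono)
  finally have "?a + ?d \<le> ?c + ?b"
    by (simp add: add.commute[of _ 1] ennreal_add_left_cancel_le)
  moreover have "?a < \<infinity> \<or> ?b < \<infinity>"
    using defd unfolding loglik_defined_def .
  (* Moving ?d and ?b to the other sides is sound unless ?a = ?b = \<infinity>, where \<infinity> - \<infinity> = \<infinity> would
     make the left-hand side too large; the definedness of the competitor excludes this. *)
  ultimately show ?thesis
    unfolding loglik_def
    by (cases ?a; cases ?b; cases ?c; cases ?d)
      (auto simp: top_ennreal.rep_eq top_unique simp flip: ennreal_plus)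
qed

text \<open>
  \<open>P\<close> maximises its own expected log-likelihood even if the maximum is \<open>\<infinity>\<close> or \<open>-\<infinity>\<close>; existence of
  the projection includes that there is no other maximiser that \<open>arg_max\<close> could choose.
\<close>

lemma KL_projection_self:
  assumes model: "statistical_model M X" and P: "P \<in> M"
    and nu: "sigma_finite_measure \<nu>" "sets \<nu> = sets borel" "absolutely_continuous \<nu> P"
    and ex: "KL_projection_exists M P \<nu> P"
  shows "KL_projection M P \<nu> P = P"
proof -
  have "is_arg_max (loglik \<nu> P) (\<lambda>P1. P1 \<in> dominated_submodel M P) P"
    unfolding is_arg_max_linorder
  proof (intro conjI allI impI)
    show "P \<in> dominated_submodel M P"
      using P by (simp add: dominated_submodel_def absolutely_continuous_def)
  next
    fix P1 assume P1: "P1 \<in> dominated_submodel M P"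
    then have "P1 \<in> M" "absolutely_continuous P P1"
      by (auto simp: dominated_submodel_def)
    moreover from this(2) have "absolutely_continuous \<nu> P1"
      using nu(3) by (auto simp: absolutely_continuous_def)
    moreover have "loglik_defined \<nu> P P1"
      using ex P1 by (simp add: KL_projection_exists_def)
    ultimately show "loglik \<nu> P P1 \<le> loglik \<nu> P P"
      using model P nu by (intro loglik_le_self) (auto simp: statistical_model_def)
  qed
  moreover have "\<exists>!P1. is_arg_max (loglik \<nu> P) (\<lambda>P1. P1 \<in> dominated_submodel M P) P1"
    using ex by (simp add: KL_projection_exists_def)
  ultimately show ?thesis
    unfolding KL_projection_def arg_max_def by (metis someI)
qed

section \<open>The difference quotient and its iterated limit\<close>

text \<open>
  The mean-zero condition under the mixture turns the linear term \<open>- \<integral> \<phi> P1 dP\<close> of the expansion into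
  \<open>\<epsilon> \<integral> \<phi> P1 d(Q - P)\<close>. The identity is exact for each fixed \<open>\<epsilon>\<close>, so that the limits can be taken
  termwise afterwards.
\<close>

lemma difference_quotient_eq:
  fixes \<Psi> :: "(real ^ 'd) measure \<Rightarrow> real"
  assumes P: "prob_space P" and Q: "prob_space Q" "sets Q = sets P" "absolutely_continuous P Q"
    and \<epsilon>: "0 < \<epsilon>" "\<epsilon> < 1"
    and int: "integrable (mixture \<epsilon> P Q) (\<phi> P1)" and mean: "(\<integral>u. \<phi> P1 u \<partial>mixture \<epsilon> P Q) = 0"
  shows "(\<Psi> P1 - \<Psi> P) / \<epsilon>
    = ((\<integral>u. \<phi> P1 u \<partial>Q) - (\<integral>u. \<phi> P1 u \<partial>P)) + remainder \<Psi> \<phi> P1 P / \<epsilon>"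
proof -
  have "(1 - \<epsilon>) * (\<integral>u. \<phi> P1 u \<partial>P) + \<epsilon> * (\<integral>u. \<phi> P1 u \<partial>Q) = 0"
    using integral_mixture[OF P Q \<epsilon> int] mean by simp
  then have "(\<integral>u. \<phi> P1 u \<partial>P) = - (\<epsilon> * ((\<integral>u. \<phi> P1 u \<partial>Q) - (\<integral>u. \<phi> P1 u \<partial>P)))"
    by (simp add: algebra_simps)
  then have "\<Psi> P1 - \<Psi> P
      = \<epsilon> * ((\<integral>u. \<phi> P1 u \<partial>Q) - (\<integral>u. \<phi> P1 u \<partial>P)) + remainder \<Psi> \<phi> P1 P"
    unfolding remainder_def by linarith
  then show ?thesis
    using \<epsilon> by (simp add: add_divide_distrib)
qed

lemma iterated_limit_add:
  assumes "iterated_limit F l" "iterated_limit F' l'"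
  shows "iterated_limit (\<lambda>\<epsilon> lam. F \<epsilon> lam + F' \<epsilon> lam) (l + l')"
proof -
  obtain L L' where L: "\<forall>\<^sub>F lam in at_right 0. ((\<lambda>\<epsilon>. F \<epsilon> lam) \<longlongrightarrow> L lam) (at_right 0)"
      "(L \<longlongrightarrow> l) (at_right 0)"
    and L': "\<forall>\<^sub>F lam in at_right 0. ((\<lambda>\<epsilon>. F' \<epsilon> lam) \<longlongrightarrow> L' lam) (at_right 0)"
      "(L' \<longlongrightarrow> l') (at_right 0)"
    using assms unfolding iterated_limit_def by blast
  have "\<forall>\<^sub>F lam in at_right 0. ((\<lambda>\<epsilon>. F \<epsilon> lam + F' \<epsilon> lam) \<longlongrightarrow> L lam + L' lam) (at_right 0)"
    using L(1) L'(1) by eventually_elim (rule tendsto_add)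
  then show ?thesis
    unfolding iterated_limit_def using tendsto_add[OF L(2) L'(2)]
    by (intro exI[of _ "\<lambda>lam. L lam + L' lam"] conjI)
qed

lemma iterated_limit_cong:
  assumes "\<forall>\<^sub>F lam in at_right 0. \<forall>\<^sub>F \<epsilon> in at_right 0. F \<epsilon> lam = F' \<epsilon> lam"
  shows "iterated_limit F l \<longleftrightarrow> iterated_limit F' l"
proof -
  have "(\<forall>\<^sub>F lam in at_right 0. ((\<lambda>\<epsilon>. F \<epsilon> lam) \<longlongrightarrow> L lam) (at_right 0))
      \<longleftrightarrow> (\<forall>\<^sub>F lam in at_right 0. ((\<lambda>\<epsilon>. F' \<epsilon> lam) \<longlongrightarrow> L lam) (at_right 0))" for L
    using assms by (intro eventually_cong) (auto elim!: eventually_mono intro!: tendsto_cong)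
  then show ?thesis
    unfolding iterated_limit_def by blast
qed

theorem theorem1:
  fixes M :: "(real ^ 'd) measure set"
    and X :: "(real ^ 'd) measure \<Rightarrow> (real ^ 'd) set"
    and \<Psi> :: "(real ^ 'd) measure \<Rightarrow> real"
    and \<phi> :: "(real ^ 'd) measure \<Rightarrow> real ^ 'd \<Rightarrow> real"
    and P \<nu> :: "(real ^ 'd) measure"
    and x :: "real ^ 'd"
    and G :: "(real ^ 'd \<Rightarrow> real) set"
    and H :: "real \<Rightarrow> (real ^ 'd) measure"
    and Pmix Pstar :: "real \<Rightarrow> real \<Rightarrow> (real ^ 'd) measure"
  assumes model: "statistical_model M X"
    and pathwise: "\<forall>Q\<in>M. pathwise_differentiable M \<Psi> Q"
    and EIF: "\<forall>Q\<in>M. is_EIF M \<Psi> Q (\<phi> Q)"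
    and P: "P \<in> M"
    and x: "x \<in> X P"
    and H: "smoothing_family P x G H"
    and nu: "sigma_finite_measure \<nu>" "sets \<nu> = sets borel" "absolutely_continuous \<nu> P"
    and Pmix_def: "\<And>\<epsilon> lam. Pmix \<epsilon> lam = mixture \<epsilon> P (H lam)"
    and Pstar_def: "\<And>\<epsilon> lam. Pstar \<epsilon> lam = KL_projection M P \<nu> (Pmix \<epsilon> lam)"
    and projection: "\<exists>\<delta>>0. \<forall>\<epsilon> lam. 0 \<le> \<epsilon> \<and> \<epsilon> < \<delta> \<and> 0 < lam \<and> lam < \<delta> \<longrightarrow>
          KL_projection_exists M P \<nu> (Pmix \<epsilon> lam) \<and> Pstar \<epsilon> lam \<in> M"
    and A1: "\<exists>\<delta>>0. \<forall>\<epsilon> lam. 0 \<le> \<epsilon> \<and> \<epsilon> < \<delta> \<and> 0 < lam \<and> lam < \<delta> \<longrightarrow>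
          integrable (Pmix \<epsilon> lam) (\<phi> (Pstar \<epsilon> lam)) \<and> (\<integral>u. \<phi> (Pstar \<epsilon> lam) u \<partial>Pmix \<epsilon> lam) = 0"
    and A2: "iterated_limit
          (\<lambda>\<epsilon> lam. (\<integral>u. \<phi> (Pstar \<epsilon> lam) u \<partial>H lam) - (\<integral>u. \<phi> (Pstar \<epsilon> lam) u \<partial>P)) (\<phi> P x)"
    and A3: "iterated_limit (\<lambda>\<epsilon> lam. remainder \<Psi> \<phi> (Pstar \<epsilon> lam) P / \<epsilon>) 0"
  shows "(\<exists>D. (\<forall>\<^sub>F lam in at_right 0.
                ((\<lambda>\<epsilon>. \<Psi> (Pstar \<epsilon> lam)) has_real_derivative D lam) (at_right 0)) \<and>
              (D \<longlongrightarrow> \<phi> P x) (at_right 0))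
         \<and> iterated_limit (\<lambda>\<epsilon> lam. (\<Psi> (Pstar \<epsilon> lam) - \<Psi> P) / \<epsilon>) (\<phi> P x)"
proof -
  have prob_P: "prob_space P" and sets_P: "sets P = sets borel"
    using model P by (auto simp: statistical_model_def)
  have H_lam: "prob_space (H lam)" "sets (H lam) = sets P" "absolutely_continuous P (H lam)"
    if "0 < lam" for lam
    using H that by (auto simp: smoothing_family_def sets_P)
  obtain \<delta>1 where \<delta>1: "\<delta>1 > 0" "\<And>\<epsilon> lam. \<lbrakk>0 \<le> \<epsilon>; \<epsilon> < \<delta>1; 0 < lam; lam < \<delta>1\<rbrakk>
      \<Longrightarrow> integrable (Pmix \<epsilon> lam) (\<phi> (Pstar \<epsilon> lam)) \<and> (\<integral>u. \<phi> (Pstar \<epsilon> lam) u \<partial>Pmix \<epsilon> lam) = 0"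
    using A1 by blast
  have quotient: "\<forall>\<^sub>F lam in at_right 0. \<forall>\<^sub>F \<epsilon> in at_right 0.
      (\<Psi> (Pstar \<epsilon> lam) - \<Psi> P) / \<epsilon>
        = ((\<integral>u. \<phi> (Pstar \<epsilon> lam) u \<partial>H lam) - (\<integral>u. \<phi> (Pstar \<epsilon> lam) u \<partial>P))
          + remainder \<Psi> \<phi> (Pstar \<epsilon> lam) P / \<epsilon>"
    using eventually_at_right_real[OF \<delta>1(1)]
  proof eventually_elim
    case (elim lam)
    (* The mixture weights must lie strictly between 0 and 1. *)
    have "0 < min \<delta>1 1" using \<delta>1(1) by simp
    from eventually_at_right_real[OF this] show ?case
    proof (rule eventually_mono)
      fix \<epsilon> assume "\<epsilon> \<in> {0<..<min \<delta>1 1}"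
      then show "(\<Psi> (Pstar \<epsilon> lam) - \<Psi> P) / \<epsilon>
        = ((\<integral>u. \<phi> (Pstar \<epsilon> lam) u \<partial>H lam) - (\<integral>u. \<phi> (Pstar \<epsilon> lam) u \<partial>P))
          + remainder \<Psi> \<phi> (Pstar \<epsilon> lam) P / \<epsilon>"
        using elim \<delta>1(2)[of \<epsilon> lam] H_lam[of lam] prob_P
        by (intro difference_quotient_eq) (auto simp: Pmix_def)
    qed
  qed
  have limit: "iterated_limit (\<lambda>\<epsilon> lam. (\<Psi> (Pstar \<epsilon> lam) - \<Psi> P) / \<epsilon>) (\<phi> P x)"
    using iterated_limit_add[OF A2 A3] iterated_limit_cong[OF quotient] by simp
  obtain \<delta>2 where \<delta>2: "\<delta>2 > 0" "\<And>\<epsilon> lam. \<lbrakk>0 \<le> \<epsilon>; \<epsilon> < \<delta>2; 0 < lam; lam < \<delta>2\<rbrakk>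
      \<Longrightarrow> KL_projection_exists M P \<nu> (Pmix \<epsilon> lam)"
    using projection by blast
  have Pstar_0: "Pstar 0 lam = P" if "0 < lam" "lam < \<delta>2" for lam
    using \<delta>2(2)[of 0 lam] \<delta>2(1) that KL_projection_self[OF model P nu]
    by (simp add: Pstar_def Pmix_def mixture_zero)
  obtain D where D: "\<forall>\<^sub>F lam in at_right 0.
        ((\<lambda>\<epsilon>. (\<Psi> (Pstar \<epsilon> lam) - \<Psi> P) / \<epsilon>) \<longlongrightarrow> D lam) (at_right 0)"
      "(D \<longlongrightarrow> \<phi> P x) (at_right 0)"
    using limit unfolding iterated_limit_def by blast
  have "\<forall>\<^sub>F lam in at_right 0. ((\<lambda>\<epsilon>. \<Psi> (Pstar \<epsilon> lam)) has_real_derivative D lam) (at_right 0)"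
    using D(1) eventually_at_right_real[OF \<delta>2(1)]
    by eventually_elim (simp add: has_field_derivative_iff Pstar_0)
  with D(2) limit show ?thesis by blast
qed
end
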